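(* Let $r,s$ be nonzero real numbers with $r+s=1$, and let $X$ and $Y$ be real normed spaces. Let $r$ be rational. An even mapping $f : X\to Y$ is quadratic if and only if the asymptotic condition $$\| f(rx+sy)+rs f(x-y)-r f(x)-s f(y)\|\to 0\quad\text{as } \|x\|+\|y\|\to\infty$$ holds true.
   Context: A mapping $f : X\to Y$ between real vector spaces is called quadratic if $f(x+y)+f(x-y)=2f(x)+2f(y)$ for all $x,y\in X$. A mapping $f$ is even if $f(-x)=f(x)$ for all $x\in X$. The asymptotic condition means: for every $\varepsilon>0$ there is $R>0$ such that the norm is at most $\varepsilon$ for all $x,y\in X$ with $\|x\|+\|y\|\ge R$.
   Formalization: The space X is assumed to be nonzero: for X = {0} the asymptotic condition is vacuous, and a constant even map with f(0) ≠ 0 satisfies it without being quadratic, so the claim fails there. *)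

theory Defs
  imports Complex_Main
begin

definition quadratic_map :: "('a::real_vector \<Rightarrow> 'b::real_vector) \<Rightarrow> bool" where
  "quadratic_map f \<longleftrightarrow> (\<forall>x y. f (x + y) + f (x - y) = 2 *\<^sub>R f x + 2 *\<^sub>R f y)"

definition even_map :: "('a::real_vector \<Rightarrow> 'b::real_vector) \<Rightarrow> bool" where
  "even_map f \<longleftrightarrow> (\<forall>x. f (- x) = f x)"

text \<open>On the zero space the following condition is vacuous: every \<open>R > 0\<close> works.\<close>

definition norm_vanishes_asymptotically ::
    "('a::real_normed_vector \<Rightarrow> 'a \<Rightarrow> 'b::real_normed_vector) \<Rightarrow> bool" where
  "norm_vanishes_asymptotically g \<longleftrightarrow>
    (\<forall>\<epsilon>>0. \<exists>R>0. \<forall>x y. norm x + norm y \<ge> R \<longrightarrow> norm (g x y) \<le> \<epsilon>)"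

end

theory Submission
  imports Defs
begin

text \<open>
  Write \<open>D x y = f (r x + s y) + r s f (x - y) - r f x - s f y\<close> for the defect of \<open>f\<close>.  On
  a nontrivial space the condition that \<open>D\<close> tends to \<open>0\<close> turns out to be equivalent to \<open>D = 0\<close>,
  so the theorem is about an exact functional equation.

  A quadratic map satisfies the second-order recurrence
  \<open>f (y + (n + 1) e) = 2 f (y + n e) - f (y + (n - 1) e) + 2 f e\<close>.  Hence along every integer
  progression it is a polynomial of degree at most two.  Refining the progression gives
  \<open>f (y + r d) = s f y + r f (y + d) - r s f d\<close> for rational \<open>r\<close>; with \<open>d = x - y\<close> this is
  \<open>D x y = 0\<close> (lemma \<open>quadratic_map_defect_eq_0\<close>).

  Conversely, an auxiliary vector \<open>z\<close> can be introduced so that \<open>D x y\<close> becomes a fixed linear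
  combination of five values of \<open>D\<close> at pairs that go to infinity with \<open>z\<close>
  (lemma \<open>defect_expansion\<close>).  As \<open>z\<close> may be chosen arbitrarily large in a nontrivial space,
  asymptotic vanishing forces \<open>D = 0\<close>.  In the equation \<open>D = 0\<close> each of the terms \<open>f (x - y)\<close>,
  \<open>f x\<close> and \<open>f y\<close> is invariant under the translations of \<open>(x, y)\<close> in one direction, and
  differencing in these three directions leaves only third differences of \<open>f\<close> itself.
  All of them vanish therefore (lemma \<open>third_difference_eq_0\<close>), and for an even map with
  \<open>f 0 = 0\<close>, which is the equation \<open>D 0 0 = 0\<close>, a special third difference is
  \<open>f (x + y) + f (x - y) - 2 f x - 2 f y\<close>.
\<close>

section \<open>The defect of the functional equation\<close>

text \<open>
  The amount by which \<open>f\<close> fails the identity for the weighted mean \<open>r x + s y\<close> that holds for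
  \<open>f x = x\<^sup>2\<close> on the reals when \<open>r + s = 1\<close>.
\<close>

definition defect :: "real \<Rightarrow> real \<Rightarrow> ('a::real_vector \<Rightarrow> 'b::real_vector) \<Rightarrow> 'a \<Rightarrow> 'a \<Rightarrow> 'b" where
  "defect r s f x y =
    f (r *\<^sub>R x + s *\<^sub>R y) + (r * s) *\<^sub>R f (x - y) - r *\<^sub>R f x - s *\<^sub>R f y"

text \<open>The defect, with the weighted mean \<open>p\<close> and the difference \<open>d\<close> as independent variables.\<close>

lemma defect_mean_difference:
  fixes f :: "'a::real_vector \<Rightarrow> 'b::real_vector"
  assumes "r + s = 1"
  shows "defect r s f (p + s *\<^sub>R d) (p - r *\<^sub>R d) =
    f p + (r * s) *\<^sub>R f d - r *\<^sub>R f (p + s *\<^sub>R d) - s *\<^sub>R f (p - r *\<^sub>R d)"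
proof -
  have "r *\<^sub>R (p + s *\<^sub>R d) + s *\<^sub>R (p - r *\<^sub>R d) = (r + s) *\<^sub>R p"
    by (simp add: algebra_simps)
  moreover have "p + s *\<^sub>R d - (p - r *\<^sub>R d) = (r + s) *\<^sub>R d"
    by (simp add: algebra_simps)
  ultimately show ?thesis
    using assms by (simp add: defect_def)
qed

section \<open>Quadratic maps have no defect for rational weights\<close>

lemma quadratic_map_0:
  fixes f :: "'a::real_vector \<Rightarrow> 'b::real_vector"
  assumes "quadratic_map f"
  shows "f 0 = 0"
proof -
  have "f (0 + 0) + f (0 - 0) = 2 *\<^sub>R f 0 + 2 *\<^sub>R f 0"
    using assms unfolding quadratic_map_def by blast
  then have "2 *\<^sub>R f 0 = 0"
    by (simp add: scaleR_2)
  then show ?thesis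
    by simp
qed

lemma quadratic_map_int_progression:
  fixes f :: "'a::real_vector \<Rightarrow> 'b::real_vector"
  assumes "quadratic_map f"
  shows "f (y + of_int n *\<^sub>R e) = (1 - of_int n) *\<^sub>R f y + of_int n *\<^sub>R f (y + e)
    + (of_int n ^ 2 - of_int n) *\<^sub>R f e"
proof -
  define T where "T t = (1 - t) *\<^sub>R f y + t *\<^sub>R f (y + e) + (t ^ 2 - t) *\<^sub>R f e" for t :: real
  have T_rec: "T (t + 1) + T (t - 1) = 2 *\<^sub>R T t + 2 *\<^sub>R f e" for t
  proof -
    have "T (t + 1) + T (t - 1) = ((1 - (t + 1)) + (1 - (t - 1))) *\<^sub>R f y
        + ((t + 1) + (t - 1)) *\<^sub>R f (y + e)
        + (((t + 1)\<^sup>2 - (t + 1)) + ((t - 1)\<^sup>2 - (t - 1))) *\<^sub>R f e"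
      unfolding T_def scaleR_left_distrib by (simp only: ac_simps)
    also have "\<dots> = (2 * (1 - t)) *\<^sub>R f y + (2 * t) *\<^sub>R f (y + e) + (2 * (t\<^sup>2 - t) + 2) *\<^sub>R f e"
    proof -
      have "(1 - (t + 1)) + (1 - (t - 1)) = 2 * (1 - t)" and "(t + 1) + (t - 1) = 2 * t"
        and "((t + 1)\<^sup>2 - (t + 1)) + ((t - 1)\<^sup>2 - (t - 1)) = 2 * (t\<^sup>2 - t) + 2"
        by (simp_all add: power2_eq_square algebra_simps)
      then show ?thesis
        by (simp only:)
    qed
    also have "\<dots> = 2 *\<^sub>R T t + 2 *\<^sub>R f e"
      unfolding T_def scaleR_left_distrib scaleR_right_distrib scaleR_scaleR
      by (simp only: ac_simps)
    finally show ?thesis .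
  qed
  have f_rec: "f (y + (t + 1) *\<^sub>R e) + f (y + (t - 1) *\<^sub>R e)
      = 2 *\<^sub>R f (y + t *\<^sub>R e) + 2 *\<^sub>R f e" for t
  proof -
    have "f ((y + t *\<^sub>R e) + e) + f ((y + t *\<^sub>R e) - e) = 2 *\<^sub>R f (y + t *\<^sub>R e) + 2 *\<^sub>R f e"
      using assms unfolding quadratic_map_def by blast
    then show ?thesis
      by (simp add: algebra_simps)
  qed
  \<comment> \<open>Two consecutive values determine a solution of the recurrence in both directions.\<close>
  have "f (y + of_int n *\<^sub>R e) = T (of_int n) \<and> f (y + (of_int n + 1) *\<^sub>R e) = T (of_int n + 1)"
  proof (induction n rule: int_induct[where k = 0])
    case base
    show ?case
      by (simp add: T_def)
  next
    case (step1 i)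
    then show ?case
      using f_rec[of "of_int i + 1"] T_rec[of "of_int i + 1"]
      by simp (metis add_right_cancel)
  next
    case (step2 i)
    then show ?case
      using f_rec[of "of_int i"] T_rec[of "of_int i"]
      by simp (metis add_left_cancel)
  qed
  then show ?thesis
    by (simp add: T_def)
qed

lemma quadratic_map_defect_eq_0:
  fixes f :: "'a::real_vector \<Rightarrow> 'b::real_vector"
  assumes quad: "quadratic_map f" and "r \<in> \<rat>" and sum: "r + s = 1"
  shows "defect r s f x y = 0"
proof -
  obtain m n :: int where "n > 0" and r: "r = of_int m / of_int n"
    using \<open>r \<in> \<rat>\<close> by (auto elim: Rats_cases')
  have s: "s = 1 - r"
    using sum by simp
  define N where "N = (of_int n :: real)"
  have "N \<noteq> 0"
    using \<open>n > 0\<close> by (simp add: N_def)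
  define d where "d = x - y"
  define e where "e = (1 / N) *\<^sub>R d"
  have m: "of_int m = r * N"
    using \<open>N \<noteq> 0\<close> r by (simp add: N_def)
  have Ne: "N *\<^sub>R e = d"
    using \<open>N \<noteq> 0\<close> by (simp add: e_def)
  have fd: "f d = N\<^sup>2 *\<^sub>R f e"
    using quadratic_map_int_progression[OF quad, of 0 n e] quadratic_map_0[OF quad] Ne
    by (simp add: N_def flip: scaleR_left_distrib)
  have fx: "f x = (1 - N) *\<^sub>R f y + N *\<^sub>R f (y + e) + (N\<^sup>2 - N) *\<^sub>R f e"
    using quadratic_map_int_progression[OF quad, of y n e] Ne
    by (simp add: N_def d_def)
  have mean: "r *\<^sub>R x + s *\<^sub>R y = y + of_int m *\<^sub>R e"
  proof -
    have "y + of_int m *\<^sub>R e = y + r *\<^sub>R d"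
      by (simp add: m Ne flip: scaleR_scaleR)
    also have "\<dots> = r *\<^sub>R x + (1 - r) *\<^sub>R y"
      by (simp add: d_def algebra_simps)
    finally show ?thesis
      by (simp add: s)
  qed
  \<comment> \<open>All values are now expressed by \<open>f y\<close>, \<open>f (y + e)\<close> and \<open>f e\<close>.\<close>
  have fmean: "f (r *\<^sub>R x + s *\<^sub>R y)
      = (1 - r * N) *\<^sub>R f y + (r * N) *\<^sub>R f (y + e) + ((r * N)\<^sup>2 - r * N) *\<^sub>R f e"
    unfolding mean using quadratic_map_int_progression[OF quad, of y m e] by (simp only: m)
  show ?thesis
    unfolding defect_def fmean d_def[symmetric] fd fx
    unfolding s
    by (simp add: algebra_simps power2_eq_square)
qed

section \<open>Asymptotic vanishing of the defect is exact vanishing\<close>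

text \<open>
  Each of \<open>f (r x + s y)\<close>, \<open>f x\<close> and \<open>f y\<close> is expanded around its argument by means of \<open>z\<close>; the
  pairs \<open>(x + s z, y + s z)\<close> and \<open>(x - r z, y - r z)\<close> then tie the three expansions together.
\<close>

lemma defect_expansion:
  fixes f :: "'a::real_vector \<Rightarrow> 'b::real_vector" and x y z :: 'a
  assumes sum: "r + s = 1"
  defines "p \<equiv> r *\<^sub>R x + s *\<^sub>R y"
  shows "defect r s f x y =
    defect r s f (p + s *\<^sub>R z) (p - r *\<^sub>R z)
    + r *\<^sub>R defect r s f (x + s *\<^sub>R z) (y + s *\<^sub>R z)
    + s *\<^sub>R defect r s f (x - r *\<^sub>R z) (y - r *\<^sub>R z)
    - r *\<^sub>R defect r s f (x + s *\<^sub>R z) (x - r *\<^sub>R z)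
    - s *\<^sub>R defect r s f (y + s *\<^sub>R z) (y - r *\<^sub>R z)"
proof -
  have mean: "r *\<^sub>R (x + w) + s *\<^sub>R (y + w) = p + w" for w
  proof -
    have "r *\<^sub>R (x + w) + s *\<^sub>R (y + w) = p + (r + s) *\<^sub>R w"
      by (simp add: p_def algebra_simps)
    then show ?thesis
      using sum by simp
  qed
  have translate: "defect r s f (x + w) (y + w) =
      f (p + w) + (r * s) *\<^sub>R f (x - y) - r *\<^sub>R f (x + w) - s *\<^sub>R f (y + w)" for w
    unfolding defect_def mean by simp
  have translate': "defect r s f (x - w) (y - w) =
      f (p - w) + (r * s) *\<^sub>R f (x - y) - r *\<^sub>R f (x - w) - s *\<^sub>R f (y - w)" for w
    using translate[of "- w"] by simp
  have s: "s = 1 - r"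
    using sum by simp
  have combination: "P + (r * s) *\<^sub>R d - r *\<^sub>R a - s *\<^sub>R b =
      P + (r * s) *\<^sub>R c - r *\<^sub>R P1 - s *\<^sub>R P2
      + r *\<^sub>R (P1 + (r * s) *\<^sub>R d - r *\<^sub>R a1 - s *\<^sub>R b1)
      + s *\<^sub>R (P2 + (r * s) *\<^sub>R d - r *\<^sub>R a2 - s *\<^sub>R b2)
      - r *\<^sub>R (a + (r * s) *\<^sub>R c - r *\<^sub>R a1 - s *\<^sub>R a2)
      - s *\<^sub>R (b + (r * s) *\<^sub>R c - r *\<^sub>R b1 - s *\<^sub>R b2)"
    for P P1 P2 a a1 a2 b b1 b2 c d :: 'b
    unfolding s by (simp add: algebra_simps)
  show ?thesis
    unfolding defect_mean_difference[OF sum] translate translate'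
    unfolding defect_def p_def[symmetric] by (rule combination)
qed

lemma exists_norm_ge:
  assumes "\<exists>x::'a::real_normed_vector. x \<noteq> 0"
  shows "\<exists>z::'a. norm z \<ge> c"
proof -
  obtain u :: 'a where "u \<noteq> 0"
    using assms by blast
  then have "norm ((c / norm u) *\<^sub>R u) = \<bar>c\<bar>"
    by simp
  then show ?thesis
    by (metis abs_ge_self)
qed

lemma defect_eq_0_if_vanishes_asymptotically:
  fixes f :: "'a::real_normed_vector \<Rightarrow> 'b::real_normed_vector"
  assumes "r \<noteq> 0" and "s \<noteq> 0" and sum: "r + s = 1"
    and nontrivial: "\<exists>x::'a. x \<noteq> 0"
    and vanishes: "norm_vanishes_asymptotically (defect r s f)"
  shows "defect r s f x y = 0"
proof -
  define C where "C = 1 + 2 * \<bar>r\<bar> + 2 * \<bar>s\<bar>"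
  have "C > 0"
    by (simp add: C_def add_pos_nonneg)
  have "norm (defect r s f x y) \<le> C * \<epsilon>" if "\<epsilon> > 0" for \<epsilon>
  proof -
    obtain R where small: "norm (defect r s f u v) \<le> \<epsilon>" if "norm u + norm v \<ge> R" for u v
      using vanishes \<open>\<epsilon> > 0\<close> unfolding norm_vanishes_asymptotically_def by blast
    obtain z :: 'a
      where z: "norm z \<ge> max R (max ((R + norm x) / \<bar>s\<bar>) ((R + norm x) / \<bar>r\<bar>))"
      using exists_norm_ge[OF nontrivial] by blast
    then have z_s: "R + norm x \<le> norm (s *\<^sub>R z)" and z_r: "R + norm x \<le> norm (r *\<^sub>R z)"
      using \<open>r \<noteq> 0\<close> \<open>s \<noteq> 0\<close> by (simp_all add: pos_divide_le_eq mult.commute)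
    \<comment> \<open>The entries of such a pair differ by \<open>z\<close>.\<close>
    have spread: "norm (defect r s f (p + s *\<^sub>R z) (p - r *\<^sub>R z)) \<le> \<epsilon>" for p
    proof (rule small)
      have "(p + s *\<^sub>R z) - (p - r *\<^sub>R z) = (r + s) *\<^sub>R z"
        by (simp add: algebra_simps)
      then have "norm z = norm ((p + s *\<^sub>R z) - (p - r *\<^sub>R z))"
        using sum by simp
      also have "\<dots> \<le> norm (p + s *\<^sub>R z) + norm (p - r *\<^sub>R z)"
        by (rule norm_triangle_ineq4)
      finally show "R \<le> norm (p + s *\<^sub>R z) + norm (p - r *\<^sub>R z)"
        using z by simp
    qed
    have up: "norm (defect r s f (x + s *\<^sub>R z) (y + s *\<^sub>R z)) \<le> \<epsilon>"
    proof (rule small)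
      show "R \<le> norm (x + s *\<^sub>R z) + norm (y + s *\<^sub>R z)"
        using norm_diff_ineq[of "s *\<^sub>R z" x, unfolded add.commute[of "s *\<^sub>R z" x]]
          z_s norm_ge_zero[of "y + s *\<^sub>R z"]
        by linarith
    qed
    have down: "norm (defect r s f (x - r *\<^sub>R z) (y - r *\<^sub>R z)) \<le> \<epsilon>"
    proof (rule small)
      show "R \<le> norm (x - r *\<^sub>R z) + norm (y - r *\<^sub>R z)"
        using norm_triangle_ineq2[of "r *\<^sub>R z" x, unfolded norm_minus_commute[of "r *\<^sub>R z" x]]
          z_r norm_ge_zero[of "y - r *\<^sub>R z"]
        by linarith
    qed
    have scaled: "norm (t *\<^sub>R v) \<le> \<bar>t\<bar> * \<epsilon>" if "norm v \<le> \<epsilon>" for t :: real and v :: 'b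
      using that by (simp add: mult_left_mono)
    have "norm (defect r s f x y) \<le> \<epsilon> + \<bar>r\<bar> * \<epsilon> + \<bar>s\<bar> * \<epsilon> + \<bar>r\<bar> * \<epsilon> + \<bar>s\<bar> * \<epsilon>"
      unfolding defect_expansion[OF sum, of f x y z]
      by (intro norm_triangle_le norm_triangle_le_diff add_mono scaled spread up down)
    also have "\<dots> = C * \<epsilon>"
      by (simp add: C_def algebra_simps)
    finally show ?thesis .
  qed
  then have "norm (defect r s f x y) \<le> 0 + \<epsilon>" if "\<epsilon> > 0" for \<epsilon>
    using that \<open>C > 0\<close> by (metis add_0 divide_pos_pos less_irrefl nonzero_mult_div_cancel_left
        times_divide_eq_right)
  then have "norm (defect r s f x y) \<le> 0"
    by (rule field_le_epsilon)
  then show ?thesis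
    by simp
qed

section \<open>Even maps without defect are quadratic\<close>

lemma third_difference_eq_0:
  fixes f :: "'a::real_vector \<Rightarrow> 'b::real_vector"
  assumes "r \<noteq> 0" and "s \<noteq> 0" and sum: "r + s = 1"
    and defect: "\<And>x y. defect r s f x y = 0"
  shows "f (p + a + b + c) - f (p + a + b) - f (p + a + c) - f (p + b + c)
    + f (p + a) + f (p + b) + f (p + c) - f p = 0"
proof -
  define b' where "b' = (1 / r) *\<^sub>R b"
  define c' where "c' = (1 / s) *\<^sub>R c"
  have b: "b = r *\<^sub>R b'" and c: "c = s *\<^sub>R c'"
    using \<open>r \<noteq> 0\<close> \<open>s \<noteq> 0\<close> by (simp_all add: b'_def c'_def)
  have eq: "f (q + r *\<^sub>R u + s *\<^sub>R v) =
      r *\<^sub>R f (q + u) + s *\<^sub>R f (q + v) - (r * s) *\<^sub>R f (u - v)" for q u v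
  proof -
    have "r *\<^sub>R (q + u) + s *\<^sub>R (q + v) = (r + s) *\<^sub>R q + r *\<^sub>R u + s *\<^sub>R v"
      by (simp add: algebra_simps)
    then have "r *\<^sub>R (q + u) + s *\<^sub>R (q + v) = q + r *\<^sub>R u + s *\<^sub>R v"
      using sum by simp
    then have "f (q + r *\<^sub>R u + s *\<^sub>R v) + (r * s) *\<^sub>R f (u - v)
        - r *\<^sub>R f (q + u) - s *\<^sub>R f (q + v) = 0"
      using defect[of "q + u" "q + v"] by (simp add: defect_def)
    then show ?thesis
      by (simp add: algebra_simps)
  qed
  \<comment> \<open>Translations by \<open>(a, a)\<close>, \<open>(b', 0)\<close> and \<open>(0, c')\<close> move the weighted mean by \<open>a\<close>, \<open>b\<close>, \<open>c\<close>.\<close>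
  have "f (p + a + b + c) - f (p + a + b) - f (p + a + c) - f (p + b + c)
      + f (p + a) + f (p + b) + f (p + c) - f p
      = (1 - (r + s)) *\<^sub>R f (p + a) - (1 - (r + s)) *\<^sub>R f p"
    unfolding b c
    unfolding eq[of "p + a" b' c'] eq[of "p + a" b' 0, simplified] eq[of "p + a" 0 c', simplified]
      eq[of p b' c'] eq[of p b' 0, simplified] eq[of p 0 c', simplified]
    by (simp add: algebra_simps)
  then show ?thesis
    using sum by simp
qed

lemma quadratic_map_if_defect_eq_0:
  fixes f :: "'a::real_vector \<Rightarrow> 'b::real_vector"
  assumes nonzero: "r \<noteq> 0" "s \<noteq> 0" and sum: "r + s = 1" and "even_map f"
    and defect: "\<And>x y. defect r s f x y = 0"
  shows "quadratic_map f"
  unfolding quadratic_map_def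
proof (intro allI)
  fix x y
  have "(r * s) *\<^sub>R f 0 + (1 - (r + s)) *\<^sub>R f 0 = 0"
    using defect[of 0 0] by (simp add: defect_def algebra_simps)
  then have "f 0 = 0"
    using nonzero sum by simp
  moreover have "f (- y) = f y"
    using \<open>even_map f\<close> by (simp add: even_map_def)
  \<comment> \<open>The third difference at \<open>- y\<close> with steps \<open>y\<close>, \<open>y\<close>, \<open>x\<close> has all its arguments among
    \<open>0\<close>, \<open>y\<close>, \<open>- y\<close>, \<open>x\<close>, \<open>x + y\<close> and \<open>x - y\<close>.\<close>
  ultimately show "f (x + y) + f (x - y) = 2 *\<^sub>R f x + 2 *\<^sub>R f y"
    using third_difference_eq_0[OF nonzero sum defect,
        where p = "- y" and a = y and b = y and c = x]
    by (simp add: scaleR_2 algebra_simps)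
qed

theorem corollary3p6:
  fixes r s :: real
    and f :: "'a::real_normed_vector \<Rightarrow> 'b::real_normed_vector"
  assumes "r \<noteq> 0" and "s \<noteq> 0" and "r + s = 1"
    and "r \<in> \<rat>"
    and nontrivial: "\<exists>x::'a. x \<noteq> 0"
    and "even_map f"
  shows "quadratic_map f \<longleftrightarrow>
    norm_vanishes_asymptotically
      (\<lambda>x y. f (r *\<^sub>R x + s *\<^sub>R y) + (r * s) *\<^sub>R f (x - y) - r *\<^sub>R f x - s *\<^sub>R f y)"
proof -
  have "quadratic_map f \<longleftrightarrow> norm_vanishes_asymptotically (defect r s f)"
  proof
    assume "quadratic_map f"
    then have "defect r s f x y = 0" for x y
      using assms(3,4) by (intro quadratic_map_defect_eq_0)
    then show "norm_vanishes_asymptotically (defect r s f)"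
      unfolding norm_vanishes_asymptotically_def by (auto intro: exI[of _ 1])
  next
    assume "norm_vanishes_asymptotically (defect r s f)"
    with assms show "quadratic_map f"
      by (intro quadratic_map_if_defect_eq_0 defect_eq_0_if_vanishes_asymptotically)
  qed
  then show ?thesis
    unfolding defect_def[abs_def] .
qed

end
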